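(* Let $X$ be a path connected, locally path connected space and $x_0\in X$. If $X$ is metrizable, then $\pi_1^{wh}(X,x_0)$ is pseudometrizable.
   Context: For a based space $(X,x_0)$, $\pi_1^{wh}(X,x_0)$ denotes the fundamental group $\pi_1(X,x_0)$ with the whisker topology: the topology having as a basis the sets $B([\zeta],U)=\{[\zeta\cdot\eta] : \eta \text{ a loop based at } x_0 \text{ with image contained in } U\}$, where $[\zeta]\in\pi_1(X,x_0)$ and $U$ is an open neighborhood of $x_0$ in $X$. Here $\zeta\cdot\eta$ is path concatenation. A space is pseudometrizable if its topology is induced by a pseudometric. *)

theory Defs
  imports "HOL-Analysis.Analysis"
begin

section \<open>The fundamental group of a based space\<close>

definition loops_at :: "'a topology \<Rightarrow> 'a \<Rightarrow> (real \<Rightarrow> 'a) set" where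
  "loops_at X x0 = {p. pathin X p \<and> p 0 = x0 \<and> p 1 = x0}"

text \<open>The library's join of paths has the same defining formula, but it requires the points to come
  from a type of class \<open>topological_space\<close>, whereas here the space is an arbitrary abstract topology.\<close>

definition path_concat :: "(real \<Rightarrow> 'a) \<Rightarrow> (real \<Rightarrow> 'a) \<Rightarrow> real \<Rightarrow> 'a" where
  "path_concat p q = (\<lambda>t. if t \<le> 1/2 then p (2 * t) else q (2 * t - 1))"

text \<open>Homotopy relative to the endpoints. Paths are functions on all of \<open>real\<close>; as in the library,
  only their values on the unit interval matter, so that functions which agree there are related.\<close>

definition loop_homotopy :: "'a topology \<Rightarrow> 'a \<Rightarrow> ((real \<Rightarrow> 'a) \<times> (real \<Rightarrow> 'a)) set" where
  "loop_homotopy X x0 =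
     {(p, q). homotopic_with (\<lambda>r. r 0 = x0 \<and> r 1 = x0) (top_of_set {0..1}) X p q}"

definition loop_class :: "'a topology \<Rightarrow> 'a \<Rightarrow> (real \<Rightarrow> 'a) \<Rightarrow> (real \<Rightarrow> 'a) set" where
  "loop_class X x0 p = loop_homotopy X x0 `` {p}"

text \<open>The underlying set of the fundamental group; the product of the classes of \<open>p\<close> and \<open>q\<close>
  is the class of \<open>path_concat p q\<close>.\<close>

definition fundamental_group :: "'a topology \<Rightarrow> 'a \<Rightarrow> (real \<Rightarrow> 'a) set set" where
  "fundamental_group X x0 = loops_at X x0 // loop_homotopy X x0"


section \<open>The whisker topology\<close>

text \<open>The set is indexed by a representative of the class; homotopic loops \<open>\<zeta>\<close> give the same set,
  by \<open>path_concat_homotopy_left\<close>.\<close>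

definition whisker_nbhd ::
    "'a topology \<Rightarrow> 'a \<Rightarrow> (real \<Rightarrow> 'a) \<Rightarrow> 'a set \<Rightarrow> (real \<Rightarrow> 'a) set set" where
  "whisker_nbhd X x0 \<zeta> U =
     {loop_class X x0 (path_concat \<zeta> \<eta>) | \<eta>. \<eta> \<in> loops_at X x0 \<and> \<eta> ` {0..1} \<subseteq> U}"

definition whisker_basis :: "'a topology \<Rightarrow> 'a \<Rightarrow> (real \<Rightarrow> 'a) set set set" where
  "whisker_basis X x0 =
     {whisker_nbhd X x0 \<zeta> U | \<zeta> U. \<zeta> \<in> loops_at X x0 \<and> openin X U \<and> x0 \<in> U}"

text \<open>The open sets are the unions of basis sets. That they do form a topology, with underlying set
  the fundamental group, is shown in \<open>openin_whisker_topology\<close> and \<open>topspace_whisker_topology\<close>.\<close>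

definition whisker_topology :: "'a topology \<Rightarrow> 'a \<Rightarrow> (real \<Rightarrow> 'a) set topology" where
  "whisker_topology X x0 = topology (arbitrary union_of (\<lambda>V. V \<in> whisker_basis X x0))"


section \<open>Pseudometrizable spaces\<close>

definition pseudometric_on :: "'a set \<Rightarrow> ('a \<Rightarrow> 'a \<Rightarrow> real) \<Rightarrow> bool" where
  "pseudometric_on M d \<longleftrightarrow>
     (\<forall>x\<in>M. \<forall>y\<in>M. 0 \<le> d x y) \<and>
     (\<forall>x\<in>M. d x x = 0) \<and>
     (\<forall>x\<in>M. \<forall>y\<in>M. d x y = d y x) \<and>
     (\<forall>x\<in>M. \<forall>y\<in>M. \<forall>z\<in>M. d x z \<le> d x y + d y z)"

definition pseudometrizable_space :: "'a topology \<Rightarrow> bool" where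
  "pseudometrizable_space T \<longleftrightarrow>
     (\<exists>d. pseudometric_on (topspace T) d \<and>
          (\<forall>U. openin T U \<longleftrightarrow>
               U \<subseteq> topspace T \<and> (\<forall>x\<in>U. \<exists>r>0. {y \<in> topspace T. d x y < r} \<subseteq> U)))"


section \<open>The whisker topology is well defined\<close>

lemma loop_homotopy_iff:
  "(p, q) \<in> loop_homotopy X x0 \<longleftrightarrow>
     (\<exists>h. continuous_map (prod_topology (top_of_set {0..1::real}) (top_of_set {0..1})) X h \<and>
          (\<forall>s\<in>{0..1}. h (0, s) = p s) \<and> (\<forall>s\<in>{0..1}. h (1, s) = q s) \<and>
          (\<forall>t\<in>{0..1}. h (t, 0) = x0 \<and> h (t, 1) = x0))"
  unfolding loop_homotopy_def mem_Collect_eq prod.case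
  by (subst homotopic_with) (simp_all add: Ball_def)

lemma loop_homotopy_imp_loops:
  "(p, q) \<in> loop_homotopy X x0 \<Longrightarrow> p \<in> loops_at X x0 \<and> q \<in> loops_at X x0"
  unfolding loop_homotopy_def loops_at_def pathin_def mem_Collect_eq prod.case
  by (frule homotopic_with_imp_continuous_maps, drule homotopic_with_imp_property) simp

lemma equiv_loop_homotopy: "equiv (loops_at X x0) (loop_homotopy X x0)"
proof (rule equivI)
  show "loop_homotopy X x0 \<subseteq> loops_at X x0 \<times> loops_at X x0"
    using loop_homotopy_imp_loops by fastforce
  show "refl_on (loops_at X x0) (loop_homotopy X x0)"
    by (auto simp: refl_on_def loop_homotopy_def loops_at_def pathin_def)
  show "sym (loop_homotopy X x0)"
    by (auto simp: sym_def loop_homotopy_def intro: homotopic_with_symD)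
  show "trans (loop_homotopy X x0)"
    by (auto simp: trans_def loop_homotopy_def intro: homotopic_with_trans)
qed

lemma loop_class_eq_iff:
  assumes "p \<in> loops_at X x0" "q \<in> loops_at X x0"
  shows "loop_class X x0 p = loop_class X x0 q \<longleftrightarrow> (p, q) \<in> loop_homotopy X x0"
  using assms equiv_loop_homotopy eq_equiv_class_iff unfolding loop_class_def by metis

lemma fundamental_group_eq: "fundamental_group X x0 = loop_class X x0 ` loops_at X x0"
  by (auto simp: fundamental_group_def quotient_def loop_class_def)

lemma const_in_loops_at: "x0 \<in> topspace X \<Longrightarrow> (\<lambda>_. x0) \<in> loops_at X x0"
  by (simp add: loops_at_def)

lemma path_concat_image: "path_concat p q ` {0..1} \<subseteq> p ` {0..1} \<union> q ` {0..1}"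
  by (auto simp: path_concat_def image_iff)

lemma path_concat_homotopy_left:
  assumes pp': "(p, p') \<in> loop_homotopy X x0" and q: "q \<in> loops_at X x0"
  shows "(path_concat p q, path_concat p' q) \<in> loop_homotopy X x0"
proof -
  let ?I = "top_of_set {0..1::real}"
  obtain h where h: "continuous_map (prod_topology ?I ?I) X h"
    "\<forall>s\<in>{0..1}. h (0, s) = p s" "\<forall>s\<in>{0..1}. h (1, s) = p' s"
    "\<forall>t\<in>{0..1}. h (t, 0) = x0 \<and> h (t, 1) = x0"
    using pp' unfolding loop_homotopy_iff by blast
  have q': "continuous_map ?I X q" "q 0 = x0" "q 1 = x0"
    using q by (auto simp: loops_at_def pathin_def)
  let ?h = "\<lambda>z. if snd z \<le> 1/2 then h (fst z, 2 * snd z) else q (2 * snd z - 1)"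
  let ?Q = "prod_topology ?I ?I"
  have Q: "?Q = top_of_set ({0..1} \<times> {0..1})"
    by simp
  have "continuous_map ?Q X ?h"
  proof (rule continuous_map_cases_le)
    show "continuous_map ?Q euclideanreal snd" "continuous_map ?Q euclideanreal (\<lambda>_. 1/2)"
      by (auto simp: Q intro!: continuous_intros)
    show "continuous_map (subtopology ?Q {z \<in> topspace ?Q. snd z \<le> 1/2}) X
            (\<lambda>z. h (fst z, 2 * snd z))"
      by (rule continuous_map_compose[OF _ h(1), unfolded o_def])
         (auto simp: Q subtopology_subtopology intro!: continuous_intros)
    show "continuous_map (subtopology ?Q {z \<in> topspace ?Q. 1/2 \<le> snd z}) X
            (\<lambda>z. q (2 * snd z - 1))"
      by (rule continuous_map_compose[OF _ q'(1), unfolded o_def])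
         (auto simp: Q subtopology_subtopology intro!: continuous_intros)
    show "h (fst z, 2 * snd z) = q (2 * snd z - 1)"
      if "z \<in> topspace ?Q" "snd z = 1/2" for z
    proof -
      have "2 * snd z = 1" "2 * snd z - 1 = 0" "fst z \<in> {0..1}"
        using that by (auto simp: Q)
      then show ?thesis
        using h(4) q'(2) by metis
    qed
  qed
  then show ?thesis
    unfolding loop_homotopy_iff using h(2-4) q'
    by (intro exI[of _ ?h]) (auto simp: path_concat_def)
qed

lemma path_concat_in_loops_at:
  assumes "p \<in> loops_at X x0" "q \<in> loops_at X x0"
  shows "path_concat p q \<in> loops_at X x0"
proof -
  have "(p, p) \<in> loop_homotopy X x0"
    using equiv_loop_homotopy assms(1) by (metis equiv_def refl_onD)
  then show ?thesis
    using path_concat_homotopy_left assms(2) loop_homotopy_imp_loops by metis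
qed

lemma loop_homotopy_reparametrize:
  assumes p: "p \<in> loops_at X x0"
    and u: "continuous_on {0..1} u" "u \<in> {0..1} \<rightarrow> {0..1}" "u 0 = 0" "u 1 = 1"
    and q: "\<And>s. s \<in> {0..1} \<Longrightarrow> q s = p (u s)"
  shows "(q, p) \<in> loop_homotopy X x0"
proof -
  let ?I = "top_of_set {0..1::real}"
  let ?Q = "prod_topology ?I ?I"
  let ?h = "\<lambda>z. (1 - fst z) * u (snd z) + fst z * snd z"
  have Q: "?Q = top_of_set ({0..1} \<times> {0..1})"
    by simp
  have p': "continuous_map ?I X p" "p 0 = x0" "p 1 = x0"
    using p by (auto simp: loops_at_def pathin_def)
  have "continuous_on ({0..1} \<times> {0..1}) ?h"
    by (intro continuous_intros continuous_on_compose2[OF u(1)]) auto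
  moreover have "?h z \<in> {0..1}" if "z \<in> {0..1} \<times> {0..1}" for z
  proof -
    have "u (snd z) \<in> {0..1}" "snd z \<in> {0..1}" "fst z \<in> {0..1}"
      using u(2) that by auto
    then show ?thesis
      using convexD_alt[of "{0..1::real}" "u (snd z)" "snd z" "fst z"] by auto
  qed
  ultimately have "continuous_map ?Q ?I ?h"
    by (auto simp: Q)
  then have "continuous_map ?Q X (\<lambda>z. p (?h z))"
    using continuous_map_compose[OF _ p'(1), unfolded o_def] by blast
  then show ?thesis
    unfolding loop_homotopy_iff using u(3,4) p' q
    by (intro exI[of _ "\<lambda>z. p (?h z)"]) auto
qed

lemma path_concat_const_right:
  assumes "p \<in> loops_at X x0"
  shows "(path_concat p (\<lambda>_. x0), p) \<in> loop_homotopy X x0"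
proof (rule loop_homotopy_reparametrize[OF assms])
  show "continuous_on {0..1} (\<lambda>s::real. min (2 * s) 1)"
    by (intro continuous_intros)
qed (use assms in \<open>auto simp: path_concat_def loops_at_def min_def\<close>)

lemma path_concat_assoc:
  assumes "p \<in> loops_at X x0" "q \<in> loops_at X x0" "r \<in> loops_at X x0"
  shows "(path_concat (path_concat p q) r, path_concat p (path_concat q r)) \<in> loop_homotopy X x0"
proof (rule loop_homotopy_reparametrize)
  let ?u = "\<lambda>s::real. min (2 * s) (min (s + 1/4) ((s + 1) / 2))"
  show "path_concat p (path_concat q r) \<in> loops_at X x0"
    using assms path_concat_in_loops_at by metis
  show "continuous_on {0..1} ?u"
    by (intro continuous_intros) auto
  fix s :: real assume s: "s \<in> {0..1}"
  consider "s \<le> 1/4" | "1/4 < s" "s \<le> 1/2" | "1/2 < s" by linarith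
  then show "path_concat (path_concat p q) r s = path_concat p (path_concat q r) (?u s)"
  proof cases
    case 1
    then have "?u s = 2 * s" by (simp add: min_def field_simps)
    with 1 show ?thesis by (simp add: path_concat_def)
  next
    case 2
    then have "?u s = s + 1/4" by (simp add: min_def field_simps)
    with 2 show ?thesis by (simp add: path_concat_def algebra_simps)
  next
    case 3
    then have "?u s = (s + 1) / 2" by (simp add: min_def field_simps)
    with 3 show ?thesis by (simp add: path_concat_def field_simps)
  qed
qed (auto simp: min_def)

lemma mem_whisker_nbhd_self:
  assumes "\<zeta> \<in> loops_at X x0" "x0 \<in> U" "openin X U"
  shows "loop_class X x0 \<zeta> \<in> whisker_nbhd X x0 \<zeta> U"
proof -
  have "x0 \<in> topspace X"
    using openin_subset[OF assms(3)] assms(2) by auto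
  then have c: "(\<lambda>_. x0) \<in> loops_at X x0"
    by (rule const_in_loops_at)
  have "loop_class X x0 \<zeta> = loop_class X x0 (path_concat \<zeta> (\<lambda>_. x0))"
    using path_concat_const_right[OF assms(1)] unfolding loop_class_def
    by (rule equiv_class_eq[OF equiv_loop_homotopy, symmetric])
  moreover have "(\<lambda>_::real. x0) ` {0..1} \<subseteq> U"
    using assms(2) by auto
  ultimately show ?thesis
    using c unfolding whisker_nbhd_def by blast
qed

lemma whisker_nbhd_shift:
  assumes "\<zeta> \<in> loops_at X x0" "\<eta> \<in> loops_at X x0" "\<eta> ` {0..1} \<subseteq> U" "\<kappa> \<in> loops_at X x0"
    and "loop_class X x0 \<kappa> = loop_class X x0 (path_concat \<zeta> \<eta>)" "W \<subseteq> U"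
  shows "whisker_nbhd X x0 \<kappa> W \<subseteq> whisker_nbhd X x0 \<zeta> U"
proof
  fix c assume "c \<in> whisker_nbhd X x0 \<kappa> W"
  then obtain \<theta> where \<theta>: "c = loop_class X x0 (path_concat \<kappa> \<theta>)"
      "\<theta> \<in> loops_at X x0" "\<theta> ` {0..1} \<subseteq> W"
    by (auto simp: whisker_nbhd_def)
  have "(\<kappa>, path_concat \<zeta> \<eta>) \<in> loop_homotopy X x0"
    using assms loop_class_eq_iff path_concat_in_loops_at by metis
  then have "(path_concat \<kappa> \<theta>, path_concat (path_concat \<zeta> \<eta>) \<theta>) \<in> loop_homotopy X x0"
    using \<theta>(2) by (rule path_concat_homotopy_left)
  then have "(path_concat \<kappa> \<theta>, path_concat \<zeta> (path_concat \<eta> \<theta>)) \<in> loop_homotopy X x0"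
    using path_concat_assoc[OF assms(1,2) \<theta>(2)] equiv_loop_homotopy[of X x0]
    by (meson equiv_def transD)
  then have "c = loop_class X x0 (path_concat \<zeta> (path_concat \<eta> \<theta>))"
    using \<theta>(1) loop_class_eq_iff loop_homotopy_imp_loops by metis
  moreover have "path_concat \<eta> \<theta> ` {0..1} \<subseteq> U"
    using path_concat_image[of \<eta> \<theta>] assms(3,6) \<theta>(3) by blast
  ultimately show "c \<in> whisker_nbhd X x0 \<zeta> U"
    using path_concat_in_loops_at[OF assms(2) \<theta>(2)] unfolding whisker_nbhd_def by blast
qed

lemma istopology_whisker:
  "istopology (arbitrary union_of (\<lambda>V. V \<in> whisker_basis X x0))"
  unfolding istopology_base_alt
proof (intro allI impI)
  have *: "(arbitrary union_of (\<lambda>V. V \<in> whisker_basis X x0)) (S \<inter> T)"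
    if "S \<in> whisker_basis X x0" "T \<in> whisker_basis X x0" for S T
  proof -
    obtain \<zeta> U where S: "S = whisker_nbhd X x0 \<zeta> U" "\<zeta> \<in> loops_at X x0" "openin X U" "x0 \<in> U"
      using \<open>S \<in> _\<close> by (auto simp: whisker_basis_def)
    obtain \<xi> V where T: "T = whisker_nbhd X x0 \<xi> V" "\<xi> \<in> loops_at X x0" "openin X V" "x0 \<in> V"
      using \<open>T \<in> _\<close> by (auto simp: whisker_basis_def)
    have "\<exists>W. W \<in> whisker_basis X x0 \<and> c \<in> W \<and> W \<subseteq> S \<inter> T" if c: "c \<in> S \<inter> T" for c
    proof -
      obtain \<eta> where \<eta>: "c = loop_class X x0 (path_concat \<zeta> \<eta>)" "\<eta> \<in> loops_at X x0" "\<eta> ` {0..1} \<subseteq> U"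
        using c S by (auto simp: whisker_nbhd_def)
      obtain \<theta> where \<theta>: "c = loop_class X x0 (path_concat \<xi> \<theta>)" "\<theta> \<in> loops_at X x0" "\<theta> ` {0..1} \<subseteq> V"
        using c T by (auto simp: whisker_nbhd_def)
      let ?\<kappa> = "path_concat \<zeta> \<eta>"
      have \<kappa>: "?\<kappa> \<in> loops_at X x0"
        using S(2) \<eta>(2) by (rule path_concat_in_loops_at)
      have UV: "openin X (U \<inter> V)" "x0 \<in> U \<inter> V"
        using S T by auto
      have "whisker_nbhd X x0 ?\<kappa> (U \<inter> V) \<subseteq> S \<inter> T"
        using whisker_nbhd_shift[OF S(2) \<eta>(2,3) \<kappa> refl, of "U \<inter> V"]
          whisker_nbhd_shift[OF T(2) \<theta>(2,3) \<kappa>, of "U \<inter> V"] \<eta>(1) \<theta>(1) S(1) T(1) by auto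
      moreover have "c \<in> whisker_nbhd X x0 ?\<kappa> (U \<inter> V)"
        using mem_whisker_nbhd_self[OF \<kappa> UV(2,1)] \<eta>(1) by simp
      moreover have "whisker_nbhd X x0 ?\<kappa> (U \<inter> V) \<in> whisker_basis X x0"
        using \<kappa> UV unfolding whisker_basis_def by blast
      ultimately show ?thesis by blast
    qed
    then show ?thesis
      unfolding arbitrary_union_of_alt by blast
  qed
  fix S T
  assume "(arbitrary union_of (\<lambda>V. V \<in> whisker_basis X x0)) S \<and>
          (arbitrary union_of (\<lambda>V. V \<in> whisker_basis X x0)) T"
  then show "(arbitrary union_of (\<lambda>V. V \<in> whisker_basis X x0)) (S \<inter> T)"
    using * arbitrary_union_of_Int_eq[of "\<lambda>V. V \<in> whisker_basis X x0"] by blast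
qed

lemma openin_whisker_topology:
  "openin (whisker_topology X x0) W \<longleftrightarrow>
     (arbitrary union_of (\<lambda>V. V \<in> whisker_basis X x0)) W"
  unfolding whisker_topology_def by (rule fun_cong[OF topology_inverse'[OF istopology_whisker]])

lemma topspace_whisker_topology:
  assumes "x0 \<in> topspace X"
  shows "topspace (whisker_topology X x0) = fundamental_group X x0"
proof
  have "V \<subseteq> fundamental_group X x0" if "V \<in> whisker_basis X x0" for V
    using that by (auto simp: whisker_basis_def whisker_nbhd_def fundamental_group_eq
        intro!: imageI path_concat_in_loops_at)
  then show "topspace (whisker_topology X x0) \<subseteq> fundamental_group X x0"
    unfolding topspace_def openin_whisker_topology arbitrary_union_of_alt by blast
  show "fundamental_group X x0 \<subseteq> topspace (whisker_topology X x0)"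
  proof
    fix c assume "c \<in> fundamental_group X x0"
    then obtain \<zeta> where \<zeta>: "\<zeta> \<in> loops_at X x0" "c = loop_class X x0 \<zeta>"
      by (auto simp: fundamental_group_eq)
    have "whisker_nbhd X x0 \<zeta> (topspace X) \<in> whisker_basis X x0"
      using \<zeta> assms unfolding whisker_basis_def by blast
    then have "openin (whisker_topology X x0) (whisker_nbhd X x0 \<zeta> (topspace X))"
      unfolding openin_whisker_topology by (rule arbitrary_union_of_inc)
    then show "c \<in> topspace (whisker_topology X x0)"
      using mem_whisker_nbhd_self[OF \<zeta>(1) assms] \<zeta>(2) openin_subset by blast
  qed
qed

end

theory Submission
  imports Defs
begin

text \<open>For a fixed open \<open>U\<close> around the base point, the classes of loops inside \<open>U\<close> form a subgroup of
  the fundamental group, because loops in \<open>U\<close> can be concatenated and reversed within \<open>U\<close>. The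
  whisker neighbourhoods with this \<open>U\<close> are the left cosets of that subgroup, so they are the classes
  of an equivalence relation (\<open>equiv_whisker_rel\<close>), which gets finer as \<open>U\<close> shrinks. In a metric
  space it is enough to let \<open>U\<close> run over the balls around the base point. The whisker topology is thus
  given by a family of equivalence relations indexed by a radius, and the infimum of the radii at
  which two points are related, capped at 1, is a pseudometric that induces such a topology
  (\<open>pseudometrizable_space_if_equiv_family\<close>). Transitivity at each single radius even gives the
  ultrametric inequality.\<close>

section \<open>Topologies given by a nested family of equivalence relations\<close>

text \<open>The cutoff at 1 keeps the infimum meaningful for points that are not related at any radius. It
  leaves the topology alone, which depends only on the small distances.\<close>

definition scale_dist :: "(real \<Rightarrow> ('b \<times> 'b) set) \<Rightarrow> 'b \<Rightarrow> 'b \<Rightarrow> real" where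
  "scale_dist R x y = Inf (insert 1 {r. 0 < r \<and> (x, y) \<in> R r})"

lemma bdd_below_scales: "bdd_below (insert 1 {r::real. 0 < r \<and> P r})"
  by (rule bdd_belowI[of _ 0]) auto

lemma scale_dist_nonneg: "0 \<le> scale_dist R x y"
  unfolding scale_dist_def by (rule cInf_greatest) auto

lemma scale_dist_le_1: "scale_dist R x y \<le> 1"
  unfolding scale_dist_def by (rule cInf_lower[OF _ bdd_below_scales]) simp

lemma scale_dist_le:
  assumes "0 < r" "(x, y) \<in> R r"
  shows "scale_dist R x y \<le> r"
  unfolding scale_dist_def by (rule cInf_lower[OF _ bdd_below_scales]) (use assms in simp)

lemma scale_dist_less_imp_related:
  assumes mono: "\<And>r s. \<lbrakk>0 < r; r \<le> s\<rbrakk> \<Longrightarrow> R r \<subseteq> R s"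
    and "scale_dist R x y < r" "r \<le> 1"
  shows "(x, y) \<in> R r"
proof -
  obtain s where "s \<in> insert 1 {r. 0 < r \<and> (x, y) \<in> R r}" "s < r"
    using assms(2) unfolding scale_dist_def by (subst (asm) cInf_less_iff[OF _ bdd_below_scales]) auto
  then show ?thesis
    using mono[of s r] assms(3) by auto
qed

lemma scale_dist_ultrametric:
  assumes mono: "\<And>r s. \<lbrakk>0 < r; r \<le> s\<rbrakk> \<Longrightarrow> R r \<subseteq> R s"
    and trans: "\<And>r. 0 < r \<Longrightarrow> trans (R r)"
  shows "scale_dist R x z \<le> max (scale_dist R x y) (scale_dist R y z)"
proof (rule dense_ge)
  fix w assume w: "max (scale_dist R x y) (scale_dist R y z) < w"
  show "scale_dist R x z \<le> w"
  proof (cases "w \<le> 1")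
    case True
    have "0 < w"
      using w scale_dist_nonneg[of R x y] by simp
    moreover have "(x, y) \<in> R w" "(y, z) \<in> R w"
      using w True by (auto intro: scale_dist_less_imp_related[where R = R, OF mono])
    ultimately show ?thesis
      using trans[of w] by (blast intro: scale_dist_le dest: transD)
  next
    case False
    then show ?thesis
      using scale_dist_le_1[of R x z] by linarith
  qed
qed

lemma pseudometrizable_space_if_equiv_family:
  fixes R :: "real \<Rightarrow> ('b \<times> 'b) set"
  assumes equiv: "\<And>r. 0 < r \<Longrightarrow> equiv (topspace T) (R r)"
    and mono: "\<And>r s. \<lbrakk>0 < r; r \<le> s\<rbrakk> \<Longrightarrow> R r \<subseteq> R s"
    and openin: "\<And>W. openin T W \<longleftrightarrow> W \<subseteq> topspace T \<and> (\<forall>x\<in>W. \<exists>r>0. R r `` {x} \<subseteq> W)"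
  shows "pseudometrizable_space T"
proof -
  let ?d = "scale_dist R"
  have "pseudometric_on (topspace T) ?d"
    unfolding pseudometric_on_def
  proof (intro conjI ballI)
    fix x y z
    show "0 \<le> ?d x y"
      by (rule scale_dist_nonneg)
    have "(x, y) \<in> R r \<longleftrightarrow> (y, x) \<in> R r" if "0 < r" for r
      using equiv[OF that] by (meson equiv_def symD)
    then have "{r. 0 < r \<and> (x, y) \<in> R r} = {r. 0 < r \<and> (y, x) \<in> R r}"
      by blast
    then show "?d x y = ?d y x"
      by (simp add: scale_dist_def)
    have "?d x z \<le> max (?d x y) (?d y z)"
      by (rule scale_dist_ultrametric) (use mono equiv in \<open>auto simp: equiv_def\<close>)
    then show "?d x z \<le> ?d x y + ?d y z"
      using scale_dist_nonneg[of R x y] scale_dist_nonneg[of R y z] by linarith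
  next
    fix x assume "x \<in> topspace T"
    then have "?d x x \<le> r" if "0 < r" for r
      using equiv[OF that] that by (auto intro: scale_dist_le simp: equiv_def refl_on_def)
    then have "?d x x \<le> 0"
      by (rule dense_ge)
    then show "?d x x = 0"
      using scale_dist_nonneg[of R x x] by linarith
  qed
  moreover have "(\<exists>r>0. R r `` {x} \<subseteq> W) \<longleftrightarrow> (\<exists>r>0. {y \<in> topspace T. ?d x y < r} \<subseteq> W)" for x W
  proof
    assume "\<exists>r>0. R r `` {x} \<subseteq> W"
    then obtain r where r: "0 < r" "R r `` {x} \<subseteq> W"
      by blast
    have "(x, y) \<in> R r" if "?d x y < min r 1" for y
      using scale_dist_less_imp_related[where R = R, OF mono that] mono[of "min r 1" r] r(1) by auto
    then have "{y \<in> topspace T. ?d x y < min r 1} \<subseteq> W"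
      using r(2) by blast
    then show "\<exists>r>0. {y \<in> topspace T. ?d x y < r} \<subseteq> W"
      using r(1) by (intro exI[of _ "min r 1"]) simp
  next
    assume "\<exists>r>0. {y \<in> topspace T. ?d x y < r} \<subseteq> W"
    then obtain r where r: "0 < r" "{y \<in> topspace T. ?d x y < r} \<subseteq> W"
      by blast
    have "y \<in> W" if y: "(x, y) \<in> R (r / 2)" for y
    proof -
      have "?d x y \<le> r / 2"
        using r(1) y by (intro scale_dist_le) auto
      moreover have "y \<in> topspace T"
        using equiv[of "r / 2"] r(1) y by (auto simp: equiv_def refl_on_def)
      ultimately show ?thesis
        using r by auto
    qed
    then show "\<exists>r>0. R r `` {x} \<subseteq> W"
      using r(1) by (intro exI[of _ "r / 2"]) auto
  qed
  ultimately show ?thesis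
    unfolding pseudometrizable_space_def openin by blast
qed


section \<open>Whisker neighbourhoods as equivalence classes\<close>

text \<open>A straight-line homotopy between the parameters \<open>u\<close> and \<open>v\<close> is carried along \<open>p\<close>. It fixes
  the endpoints because \<open>u\<close> and \<open>v\<close> agree there. Their common endpoints may be any parameters
  that \<open>p\<close> sends to the base point, so the homotopy can also cancel a detour along \<open>p\<close>.\<close>

lemma loop_homotopy_along_path:
  assumes p: "pathin X p"
    and u: "continuous_on {0..1} u" "u \<in> {0..1} \<rightarrow> {0..1}"
    and v: "continuous_on {0..1} v" "v \<in> {0..1} \<rightarrow> {0..1}"
    and ends: "u 0 = v 0" "u 1 = v 1" "p (u 0) = x0" "p (u 1) = x0"
    and q: "\<And>s. s \<in> {0..1} \<Longrightarrow> q s = p (u s)"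
    and r: "\<And>s. s \<in> {0..1} \<Longrightarrow> r s = p (v s)"
  shows "(q, r) \<in> loop_homotopy X x0"
proof -
  let ?I = "top_of_set {0..1::real}"
  let ?Q = "prod_topology ?I ?I"
  let ?h = "\<lambda>z. (1 - fst z) * u (snd z) + fst z * v (snd z)"
  have "continuous_on ({0..1} \<times> {0..1}) ?h"
    by (intro continuous_intros continuous_on_compose2[OF u(1)] continuous_on_compose2[OF v(1)]) auto
  moreover have "?h z \<in> {0..1}" if "z \<in> {0..1} \<times> {0..1}" for z
  proof -
    have "u (snd z) \<in> {0..1}" "v (snd z) \<in> {0..1}" "fst z \<in> {0..1}"
      using u(2) v(2) that by auto
    then show ?thesis
      using convexD_alt[of "{0..1::real}" "u (snd z)" "v (snd z)" "fst z"] by auto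
  qed
  ultimately have "continuous_map ?Q ?I ?h"
    by auto
  then have "continuous_map ?Q X (\<lambda>z. p (?h z))"
    using p continuous_map_compose[of ?Q ?I ?h X p] by (simp add: pathin_def o_def)
  moreover have "(1 - t) * v 0 + t * v 0 = v 0" "(1 - t) * v 1 + t * v 1 = v 1" for t
    by (simp_all add: algebra_simps)
  ultimately show ?thesis
    unfolding loop_homotopy_iff using ends q r
    by (intro exI[of _ "\<lambda>z. p (?h z)"]) auto
qed

lemma reverse_in_loops_at:
  assumes "\<eta> \<in> loops_at X x0"
  shows "(\<lambda>t. \<eta> (1 - t)) \<in> loops_at X x0"
proof -
  have "continuous_map (top_of_set {0..1::real}) (top_of_set {0..1}) (\<lambda>t. 1 - t)"
    by (auto intro!: continuous_intros)
  then have "pathin X (\<eta> \<circ> (\<lambda>t. 1 - t))"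
    using assms unfolding loops_at_def pathin_def by (blast intro: continuous_map_compose)
  then show ?thesis
    using assms by (simp add: loops_at_def o_def)
qed

text \<open>Following \<open>\<zeta>\<close>, then \<open>\<eta>\<close>, then \<open>\<eta>\<close> backwards traverses the single path \<open>path_concat \<zeta> \<eta>\<close> up to its
  end and then back to its midpoint; pulling the excursion back leaves the first half, which is
  \<open>\<zeta>\<close>.\<close>

lemma path_concat_reverse_cancel:
  assumes "\<zeta> \<in> loops_at X x0" "\<eta> \<in> loops_at X x0"
  shows "(path_concat (path_concat \<zeta> \<eta>) (\<lambda>t. \<eta> (1 - t)), \<zeta>) \<in> loop_homotopy X x0"
proof (rule loop_homotopy_along_path
    [where p = "path_concat \<zeta> \<eta>" and u = "\<lambda>s. min (2 * s) (3 / 2 - s)" and v = "\<lambda>s. s / 2"])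
  let ?u = "\<lambda>s::real. min (2 * s) (3 / 2 - s)" and ?v = "\<lambda>s::real. s / 2"
  show "pathin X (path_concat \<zeta> \<eta>)"
    using path_concat_in_loops_at[OF assms] by (simp add: loops_at_def)
  show "continuous_on {0..1} ?u" "continuous_on {0..1} ?v"
    by (intro continuous_intros; simp)+
  fix s :: real assume s: "s \<in> {0..1}"
  show "path_concat (path_concat \<zeta> \<eta>) (\<lambda>t. \<eta> (1 - t)) s = path_concat \<zeta> \<eta> (?u s)"
  proof -
    consider "s \<le> 1/2" | "1/2 < s" "s < 1" | "s = 1"
      using s by fastforce
    then show ?thesis
    proof cases
      case 1
      then have "?u s = 2 * s" by (simp add: min_def)
      with 1 show ?thesis by (simp add: path_concat_def)
    next
      case 2
      then have "?u s = 3 / 2 - s" by (simp add: min_def)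
      moreover have "1 - (2 * s - 1) = 2 * (3 / 2 - s) - 1" by simp
      ultimately show ?thesis using 2 by (simp add: path_concat_def)
    next
      case 3
      \<comment> \<open>At \<open>s = 1\<close> the parameter is \<open>1 / 2\<close>, where \<open>path_concat\<close> takes the value of \<open>\<zeta>\<close>; it agrees
        with \<open>\<eta> 0\<close> since both are the base point.\<close>
      then show ?thesis using assms by (simp add: path_concat_def loops_at_def)
    qed
  qed
  show "\<zeta> s = path_concat \<zeta> \<eta> (?v s)"
    using s by (simp add: path_concat_def)
qed (use assms in \<open>auto simp: path_concat_def loops_at_def min_def\<close>)

text \<open>Two classes are related if they lie in the same left coset of the subgroup of classes of loops
  in \<open>U\<close>. Cosets are indexed here by representative loops, so the relation asks for some
  representative of the first class; by \<open>whisker_rel_Image\<close> the choice makes no difference.\<close>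

definition whisker_rel ::
    "'a topology \<Rightarrow> 'a \<Rightarrow> 'a set \<Rightarrow> ((real \<Rightarrow> 'a) set \<times> (real \<Rightarrow> 'a) set) set" where
  "whisker_rel X x0 U =
     {(c, c') | c c'. \<exists>\<zeta>\<in>loops_at X x0. c = loop_class X x0 \<zeta> \<and> c' \<in> whisker_nbhd X x0 \<zeta> U}"

lemma whisker_nbhd_mono:
  assumes "U \<subseteq> V"
  shows "whisker_nbhd X x0 \<zeta> U \<subseteq> whisker_nbhd X x0 \<zeta> V"
proof
  fix c assume "c \<in> whisker_nbhd X x0 \<zeta> U"
  then obtain \<eta> where "c = loop_class X x0 (path_concat \<zeta> \<eta>)" "\<eta> \<in> loops_at X x0" "\<eta> ` {0..1} \<subseteq> U"
    unfolding whisker_nbhd_def by blast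
  then show "c \<in> whisker_nbhd X x0 \<zeta> V"
    using assms subset_trans unfolding whisker_nbhd_def by blast
qed

lemma whisker_rel_mono:
  assumes "U \<subseteq> V"
  shows "whisker_rel X x0 U \<subseteq> whisker_rel X x0 V"
proof (rule subrelI)
  fix c c' assume "(c, c') \<in> whisker_rel X x0 U"
  then obtain \<zeta> where "\<zeta> \<in> loops_at X x0" "c = loop_class X x0 \<zeta>" "c' \<in> whisker_nbhd X x0 \<zeta> U"
    unfolding whisker_rel_def by blast
  moreover from this have "c' \<in> whisker_nbhd X x0 \<zeta> V"
    using subsetD[OF whisker_nbhd_mono[OF assms]] by simp
  ultimately show "(c, c') \<in> whisker_rel X x0 V"
    unfolding whisker_rel_def by blast
qed

lemma whisker_nbhd_absorb:
  assumes "\<zeta> \<in> loops_at X x0" "\<kappa> \<in> loops_at X x0"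
    and "loop_class X x0 \<kappa> \<in> whisker_nbhd X x0 \<zeta> U" "W \<subseteq> U"
  shows "whisker_nbhd X x0 \<kappa> W \<subseteq> whisker_nbhd X x0 \<zeta> U"
proof -
  obtain \<eta> where "\<eta> \<in> loops_at X x0" "\<eta> ` {0..1} \<subseteq> U"
      "loop_class X x0 \<kappa> = loop_class X x0 (path_concat \<zeta> \<eta>)"
    using assms(3) unfolding whisker_nbhd_def by blast
  then show ?thesis
    by (rule whisker_nbhd_shift[OF assms(1) _ _ assms(2) _ assms(4)])
qed

lemma whisker_rel_Image:
  assumes "\<zeta> \<in> loops_at X x0" "openin X U" "x0 \<in> U"
  shows "whisker_rel X x0 U `` {loop_class X x0 \<zeta>} = whisker_nbhd X x0 \<zeta> U"
proof -
  have "whisker_nbhd X x0 \<kappa> U \<subseteq> whisker_nbhd X x0 \<zeta> U"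
    if "\<kappa> \<in> loops_at X x0" "loop_class X x0 \<zeta> = loop_class X x0 \<kappa>" for \<kappa>
    using whisker_nbhd_absorb[OF assms(1) that(1) _ order_refl]
      mem_whisker_nbhd_self[OF assms(1,3,2)] that(2) by simp
  then show ?thesis
    using assms(1) unfolding whisker_rel_def by blast
qed

lemma whisker_nbhd_subset_fundamental_group:
  assumes "\<zeta> \<in> loops_at X x0"
  shows "whisker_nbhd X x0 \<zeta> U \<subseteq> fundamental_group X x0"
proof
  fix c assume "c \<in> whisker_nbhd X x0 \<zeta> U"
  then obtain \<eta> where "c = loop_class X x0 (path_concat \<zeta> \<eta>)" "\<eta> \<in> loops_at X x0"
    unfolding whisker_nbhd_def by blast
  then show "c \<in> fundamental_group X x0"
    using path_concat_in_loops_at[OF assms] by (simp add: fundamental_group_eq)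
qed

lemma equiv_whisker_rel:
  assumes "openin X U" "x0 \<in> U"
  shows "equiv (fundamental_group X x0) (whisker_rel X x0 U)"
proof (rule equivI)
  show "whisker_rel X x0 U \<subseteq> fundamental_group X x0 \<times> fundamental_group X x0"
    using whisker_nbhd_subset_fundamental_group
    by (fastforce simp: whisker_rel_def fundamental_group_eq)
  show "refl_on (fundamental_group X x0) (whisker_rel X x0 U)"
    using mem_whisker_nbhd_self[OF _ assms(2,1)]
    by (auto simp: refl_on_def whisker_rel_def fundamental_group_eq)
  show "sym (whisker_rel X x0 U)"
  proof (rule symI)
    fix c c' assume "(c, c') \<in> whisker_rel X x0 U"
    then obtain \<zeta> \<eta> where *: "\<zeta> \<in> loops_at X x0" "c = loop_class X x0 \<zeta>"
        "\<eta> \<in> loops_at X x0" "\<eta> ` {0..1} \<subseteq> U" "c' = loop_class X x0 (path_concat \<zeta> \<eta>)"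
      by (auto simp: whisker_rel_def whisker_nbhd_def)
    let ?\<eta>' = "\<lambda>t. \<eta> (1 - t)"
    have "c = loop_class X x0 (path_concat (path_concat \<zeta> \<eta>) ?\<eta>')"
      using path_concat_reverse_cancel[OF *(1,3)] *(2) loop_class_eq_iff loop_homotopy_imp_loops
      by metis
    moreover have "?\<eta>' ` {0..1} \<subseteq> U"
      using *(4) by auto
    ultimately have "c \<in> whisker_nbhd X x0 (path_concat \<zeta> \<eta>) U"
      using reverse_in_loops_at[OF *(3)] unfolding whisker_nbhd_def by blast
    then show "(c', c) \<in> whisker_rel X x0 U"
      using path_concat_in_loops_at[OF *(1,3)] *(5) unfolding whisker_rel_def by blast
  qed
  show "trans (whisker_rel X x0 U)"
  proof (rule transI)
    fix a b c assume "(a, b) \<in> whisker_rel X x0 U" "(b, c) \<in> whisker_rel X x0 U"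
    then obtain \<zeta> \<kappa> where *: "\<zeta> \<in> loops_at X x0" "a = loop_class X x0 \<zeta>" "b \<in> whisker_nbhd X x0 \<zeta> U"
        "\<kappa> \<in> loops_at X x0" "b = loop_class X x0 \<kappa>" "c \<in> whisker_nbhd X x0 \<kappa> U"
      unfolding whisker_rel_def by blast
    then have "c \<in> whisker_nbhd X x0 \<zeta> U"
      using whisker_nbhd_absorb[OF *(1,4) _ order_refl] by auto
    then show "(a, c) \<in> whisker_rel X x0 U"
      using *(1,2) unfolding whisker_rel_def by blast
  qed
qed

text \<open>A basis set containing the class of \<open>\<zeta>\<close> may be centred elsewhere, but by absorption it also
  contains the whisker neighbourhood with the same \<open>U\<close> centred at \<open>\<zeta>\<close>.\<close>

lemma openin_whisker_topology_iff:
  assumes "x0 \<in> topspace X"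
  shows "openin (whisker_topology X x0) W \<longleftrightarrow>
     W \<subseteq> fundamental_group X x0 \<and>
     (\<forall>\<zeta>\<in>loops_at X x0. loop_class X x0 \<zeta> \<in> W \<longrightarrow>
        (\<exists>U. openin X U \<and> x0 \<in> U \<and> whisker_nbhd X x0 \<zeta> U \<subseteq> W))"
    (is "_ \<longleftrightarrow> _ \<and> ?nbhds")
proof (intro iffI conjI)
  assume W: "openin (whisker_topology X x0) W"
  show "W \<subseteq> fundamental_group X x0"
    using openin_subset[OF W] topspace_whisker_topology[OF assms] by simp
  show ?nbhds
  proof (intro ballI impI)
    fix \<zeta> assume \<zeta>: "\<zeta> \<in> loops_at X x0" "loop_class X x0 \<zeta> \<in> W"
    then obtain B where B: "B \<in> whisker_basis X x0" "loop_class X x0 \<zeta> \<in> B" "B \<subseteq> W"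
      using W unfolding openin_whisker_topology arbitrary_union_of_alt by blast
    then obtain \<xi> U where U: "B = whisker_nbhd X x0 \<xi> U" "\<xi> \<in> loops_at X x0" "openin X U" "x0 \<in> U"
      by (auto simp: whisker_basis_def)
    then have "whisker_nbhd X x0 \<zeta> U \<subseteq> W"
      using whisker_nbhd_absorb[OF U(2) \<zeta>(1) _ order_refl] B by blast
    then show "\<exists>U. openin X U \<and> x0 \<in> U \<and> whisker_nbhd X x0 \<zeta> U \<subseteq> W"
      using U by blast
  qed
next
  assume W: "W \<subseteq> fundamental_group X x0 \<and> ?nbhds"
  have "\<exists>B. B \<in> whisker_basis X x0 \<and> c \<in> B \<and> B \<subseteq> W" if "c \<in> W" for c
  proof -
    obtain \<zeta> where \<zeta>: "\<zeta> \<in> loops_at X x0" "c = loop_class X x0 \<zeta>"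
      using W \<open>c \<in> W\<close> by (auto simp: fundamental_group_eq)
    then obtain U where "openin X U" "x0 \<in> U" "whisker_nbhd X x0 \<zeta> U \<subseteq> W"
      using W \<open>c \<in> W\<close> by blast
    then show ?thesis
      using \<zeta> mem_whisker_nbhd_self[OF \<zeta>(1)] unfolding whisker_basis_def by blast
  qed
  then show "openin (whisker_topology X x0) W"
    unfolding openin_whisker_topology arbitrary_union_of_alt by blast
qed


section \<open>Pseudometrizability\<close>

theorem theorem5p5:
  fixes X :: "'a topology" and x0 :: 'a
  assumes "path_connected_space X"
    and "locally_path_connected_space X"
    and "x0 \<in> topspace X"
    and "metrizable_space X"
  shows "pseudometrizable_space (whisker_topology X x0)"
proof -
  obtain M d where "Metric_space M d" and X: "X = Metric_space.mtopology M d"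
    using assms(4) unfolding metrizable_space_def by blast
  interpret Metric_space M d by fact
  have x0: "x0 \<in> M"
    using assms(3) by (simp add: X)
  have ball: "openin X (mball x0 r)" "x0 \<in> mball x0 r" if "0 < r" for r
    using that x0 by (auto simp: X)
  let ?R = "\<lambda>r. whisker_rel X x0 (mball x0 r)"
  have top: "topspace (whisker_topology X x0) = fundamental_group X x0"
    by (rule topspace_whisker_topology[OF assms(3)])
  show ?thesis
  proof (rule pseudometrizable_space_if_equiv_family[where R = ?R])
    show "equiv (topspace (whisker_topology X x0)) (?R r)" if "0 < r" for r
      unfolding top using equiv_whisker_rel[OF ball[OF that]] .
    show "?R r \<subseteq> ?R s" if "r \<le> s" for r s
      using that by (intro whisker_rel_mono mball_subset_concentric)
    fix W
    have "(\<exists>U. openin X U \<and> x0 \<in> U \<and> whisker_nbhd X x0 \<zeta> U \<subseteq> W) \<longleftrightarrow>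
          (\<exists>r>0. ?R r `` {loop_class X x0 \<zeta>} \<subseteq> W)" if \<zeta>: "\<zeta> \<in> loops_at X x0" for \<zeta>
    proof
      assume "\<exists>U. openin X U \<and> x0 \<in> U \<and> whisker_nbhd X x0 \<zeta> U \<subseteq> W"
      then obtain U where U: "openin X U" "x0 \<in> U" "whisker_nbhd X x0 \<zeta> U \<subseteq> W"
        by blast
      then obtain r where "0 < r" "mball x0 r \<subseteq> U"
        unfolding X openin_mtopology by blast
      moreover from this have "?R r `` {loop_class X x0 \<zeta>} \<subseteq> W"
        using whisker_rel_mono[of "mball x0 r" U X x0] whisker_rel_Image[OF \<zeta> U(1,2)] U(3) by blast
      ultimately show "\<exists>r>0. ?R r `` {loop_class X x0 \<zeta>} \<subseteq> W"
        by blast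
    next
      assume "\<exists>r>0. ?R r `` {loop_class X x0 \<zeta>} \<subseteq> W"
      then show "\<exists>U. openin X U \<and> x0 \<in> U \<and> whisker_nbhd X x0 \<zeta> U \<subseteq> W"
        using whisker_rel_Image[OF \<zeta> ball] ball by metis
    qed
    then show "openin (whisker_topology X x0) W \<longleftrightarrow>
        W \<subseteq> topspace (whisker_topology X x0) \<and> (\<forall>c\<in>W. \<exists>r>0. ?R r `` {c} \<subseteq> W)"
      unfolding openin_whisker_topology_iff[OF assms(3)] top
      by (auto simp: fundamental_group_eq)
  qed
qed

end
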